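(* Consider a non-sequential $N$-DM system which has Property C with ordering map $\psi$. Then for any admissible team policy $\gamma=(\gamma^1,\dots,\gamma^N)\in\Gamma$ there exists a sequential system with $N$ ("imaginary") decision makers, the $k$-th of which acts $k$-th, such that for each $k=1,\dots,N$: its measurement space is $\bar{\mathbb{Y}}^k=\bigcup_{i=1}^N\mathbb{Y}^i$ and its action space is $\bar{\mathbb{U}}^k=\bigcup_{i=1}^N\mathbb{U}^i$; its measurement is $\bar y^k=\sum_{i=1}^N\eta^i(\omega,\mathbf{u})1_{\{s_k=i\}}$; its action is $\bar u^k=\sum_{i=1}^Nu^i1_{\{s_k=i\}}$; and its policy is given by $$\bar u^k=\gamma^i(y^i)\ \text{ if }\ \psi_k(\omega_{s_0},\bar u^1,\dots,\bar u^{k-1})=s_k=i,\qquad\text{i.e. } \bar u^k=\bar\gamma^k(\bar y^k,s_k).$$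
   Context: **Model.** A non-sequential system with $N\in\mathbb{N}$ decision makers (DMs) consists of: a probability space $(\Omega,\mathcal{F},P)$; standard Borel action spaces $(\mathbb{U}^i,\mathcal{U}^i)$ and standard Borel measurement spaces $(\mathbb{Y}^i,\mathcal{Y}^i)$, $i=1,\dots,N$; measurable measurement functions $\eta^i:\Omega\times\prod_{k=1}^N\mathbb{U}^k\to\mathbb{Y}^i$, giving the measurement $y^i=\eta^i(\omega,\mathbf{u})$ of DM $i$, where $\mathbf{u}=(u^1,\dots,u^N)$. An admissible policy is $\gamma=(\gamma^1,\dots,\gamma^N)\in\Gamma$ with each $\gamma^i:\mathbb{Y}^i\to\mathbb{U}^i$ measurable, $u^i=\gamma^i(y^i)$. The random variable $\omega_{s_0}$ on $(\Omega,\mathcal{F})$ is the part of the exogenous randomness $\omega$ relevant to the ordering of DMs. A system is sequential if there is a pre-defined (deterministic) order in which its DMs act. **Orderings.** $S_k$ is the set of $k$-DM orderings $(s_1,\dots,s_k)$ (sequences of $k$ distinct elements of $\{1,\dots,N\}$); $s_j=i$ means that DM $i$ is the $j$-th to act. $T^N_k:S_N\to S_k$ is truncation to the first $k$ entries. An ordering map is a map $\psi:\Omega\times\prod_i\mathbb{U}^i\to S_N$ (depending on $\omega$ through $\omega_{s_0}$), $\psi(\omega,\mathbf{u})=(s_1,\dots,s_N)$; $\psi_k(\omega,\mathbf{u}):=s_k$. Under Property C, $\psi_k$ is a function of $\omega_{s_0}$ and of the actions $\bar u^1,\dots,\bar u^{k-1}$ only, which is the notation $\psi_k(\omega_{s_0},\bar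 u^1,\dots,\bar u^{k-1})$. **Induced objects.** $\bar y^k$ equals $\eta^i(\omega,\mathbf{u})$ when $s_k=i$, and $\bar u^k$ equals $u^i$ when $s_k=i$. The unions $\bigcup_i\mathbb{Y}^i$, $\bigcup_i\mathbb{U}^i$ are regarded as standard Borel spaces containing the $\mathbb{Y}^i$ (resp. $\mathbb{U}^i$) as measurable subspaces. $\bar{\mathscr{J}}^k$ is the smallest $\sigma$-algebra on $\Omega\times\prod_i\mathbb{U}^i$ making $\bar y^k$ measurable, and $\mathscr{F}^*(k)$ the smallest one making $(\omega,\bar u^1,\dots,\bar u^k)$ measurable. **Property C (Causality) with ordering map $\psi$.** For all $k\in\{1,\dots,N\}$ and $s\in S_k$, $\{E\cap[T^N_k\circ\psi]^{-1}(s)\mid E\in\bar{\mathscr{J}}^k\}\subseteq\mathscr{F}^*(k-1)$. *)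

theory Defs
  imports "HOL-Probability.Probability"
begin

definition standard_borel :: "'a measure \<Rightarrow> bool" where
  "standard_borel M \<longleftrightarrow>
     (\<exists>X. topspace X = space M \<and> completely_metrizable_space X \<and> second_countable X \<and>
          sets M = sigma_sets (space M) {V. openin X V})"

text \<open>
  Decision makers are indexed by \<open>{1..N}\<close>. Their measurement and action spaces are
  given as measurable spaces \<open>Y i\<close>, \<open>U i\<close>, all carried by common types \<open>'y\<close>, \<open>'u\<close> (the
  carriers may overlap); of these only \<open>space\<close> and \<open>sets\<close> are used.
\<close>

definition joint_actions :: "nat \<Rightarrow> (nat \<Rightarrow> 'u measure) \<Rightarrow> (nat \<Rightarrow> 'u) measure" where
  "joint_actions N U = Pi\<^sub>M {1..N} U"

definition dm_system ::
  "'w measure \<Rightarrow> nat \<Rightarrow> (nat \<Rightarrow> 'y measure) \<Rightarrow> (nat \<Rightarrow> 'u measure)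
     \<Rightarrow> (nat \<Rightarrow> 'w \<times> (nat \<Rightarrow> 'u) \<Rightarrow> 'y) \<Rightarrow> bool" where
  "dm_system P N Y U \<eta> \<longleftrightarrow>
     prob_space P \<and>
     (\<forall>i\<in>{1..N}. standard_borel (Y i) \<and>
        standard_borel (U i) \<and> space (U i) \<noteq> {} \<and>
        \<eta> i \<in> P \<Otimes>\<^sub>M joint_actions N U \<rightarrow>\<^sub>M Y i)"

definition policies ::
  "nat \<Rightarrow> (nat \<Rightarrow> 'y measure) \<Rightarrow> (nat \<Rightarrow> 'u measure) \<Rightarrow> (nat \<Rightarrow> 'y \<Rightarrow> 'u) set" where
  "policies N Y U = {\<gamma>. \<forall>i\<in>{1..N}. \<gamma> i \<in> Y i \<rightarrow>\<^sub>M U i}"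

definition orderings :: "nat \<Rightarrow> nat \<Rightarrow> nat list set" where
  "orderings N k = {s. length s = k \<and> distinct s \<and> set s \<subseteq> {1..N}}"

text \<open>List positions start at 0, positions in an ordering at 1.\<close>

definition acting :: "nat list \<Rightarrow> nat \<Rightarrow> nat" where
  "acting s k = s ! (k - 1)"

text \<open>
  A system is sequential with respect to a fixed order \<open>s\<close> if the measurement of the
  \<open>k\<close>-th acting DM depends only on \<open>\<omega>\<close> and on the actions of those that acted before it.
\<close>

definition sequential_system ::
  "'w measure \<Rightarrow> nat \<Rightarrow> (nat \<Rightarrow> 'y measure) \<Rightarrow> (nat \<Rightarrow> 'u measure)
     \<Rightarrow> (nat \<Rightarrow> 'w \<times> (nat \<Rightarrow> 'u) \<Rightarrow> 'y) \<Rightarrow> nat list \<Rightarrow> bool" where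
  "sequential_system P N Y U \<eta> s \<longleftrightarrow>
     dm_system P N Y U \<eta> \<and> s \<in> orderings N N \<and>
     (\<forall>k\<in>{1..N}. \<forall>\<omega>\<in>space P.
        \<forall>u\<in>space (joint_actions N U). \<forall>u'\<in>space (joint_actions N U).
          (\<forall>j\<in>{1..<k}. u (acting s j) = u' (acting s j)) \<longrightarrow>
          \<eta> (acting s k) (\<omega>, u) = \<eta> (acting s k) (\<omega>, u'))"

definition ordering_map ::
  "'w measure \<Rightarrow> nat \<Rightarrow> (nat \<Rightarrow> 'u measure) \<Rightarrow> ('w \<Rightarrow> 's)
     \<Rightarrow> ('w \<times> (nat \<Rightarrow> 'u) \<Rightarrow> nat list) \<Rightarrow> bool" where
  "ordering_map P N U \<omega>s \<psi> \<longleftrightarrow>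
     (\<forall>\<omega>\<in>space P. \<forall>u\<in>space (joint_actions N U). \<psi> (\<omega>, u) \<in> orderings N N) \<and>
     (\<exists>h. \<forall>\<omega>\<in>space P. \<forall>u\<in>space (joint_actions N U). \<psi> (\<omega>, u) = h (\<omega>s \<omega>) u)"

text \<open>
  \<open>Z\<close> is the union of the \<open>X i\<close>, as a standard Borel space in which each \<open>X i\<close> is a
  measurable subspace. This determines \<open>sets Z\<close>; that such a \<open>Z\<close> exists is a condition
  on how the carriers overlap.
\<close>

definition union_space :: "nat \<Rightarrow> (nat \<Rightarrow> 'a measure) \<Rightarrow> 'a measure \<Rightarrow> bool" where
  "union_space N X Z \<longleftrightarrow>
     standard_borel Z \<and> space Z = (\<Union>i\<in>{1..N}. space (X i)) \<and>
     (\<forall>i\<in>{1..N}. space (X i) \<in> sets Z \<and>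
        sets (X i) = sets (restrict_space Z (space (X i))))"

text \<open>
  The sums \<open>\<Sum>i. \<eta> i (\<omega>, u) * 1{s_k = i}\<close> and \<open>\<Sum>i. u i * 1{s_k = i}\<close> have exactly one
  term with nonzero indicator and only select that term, as the spaces are not additive.
\<close>

definition ybar ::
  "(nat \<Rightarrow> 'w \<times> (nat \<Rightarrow> 'u) \<Rightarrow> 'y) \<Rightarrow> ('w \<times> (nat \<Rightarrow> 'u) \<Rightarrow> nat list)
     \<Rightarrow> nat \<Rightarrow> 'w \<times> (nat \<Rightarrow> 'u) \<Rightarrow> 'y" where
  "ybar \<eta> \<psi> k x = \<eta> (acting (\<psi> x) k) x"

definition ubar ::
  "('w \<times> (nat \<Rightarrow> 'u) \<Rightarrow> nat list) \<Rightarrow> nat \<Rightarrow> 'w \<times> (nat \<Rightarrow> 'u) \<Rightarrow> 'u" where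
  "ubar \<psi> k x = snd x (acting (\<psi> x) k)"

definition ubars ::
  "('w \<times> (nat \<Rightarrow> 'u) \<Rightarrow> nat list) \<Rightarrow> nat \<Rightarrow> 'w \<times> (nat \<Rightarrow> 'u) \<Rightarrow> nat \<Rightarrow> 'u" where
  "ubars \<psi> k x = (\<lambda>j\<in>{1..k}. ubar \<psi> j x)"

definition Jbar ::
  "'w measure \<Rightarrow> nat \<Rightarrow> (nat \<Rightarrow> 'u measure) \<Rightarrow> (nat \<Rightarrow> 'w \<times> (nat \<Rightarrow> 'u) \<Rightarrow> 'y) \<Rightarrow> 'y measure
     \<Rightarrow> ('w \<times> (nat \<Rightarrow> 'u) \<Rightarrow> nat list) \<Rightarrow> nat \<Rightarrow> ('w \<times> (nat \<Rightarrow> 'u)) measure" where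
  "Jbar P N U \<eta> Yb \<psi> k =
     vimage_algebra (space (P \<Otimes>\<^sub>M joint_actions N U)) (ybar \<eta> \<psi> k) Yb"

definition Fstar ::
  "'w measure \<Rightarrow> nat \<Rightarrow> (nat \<Rightarrow> 'u measure) \<Rightarrow> 'u measure
     \<Rightarrow> ('w \<times> (nat \<Rightarrow> 'u) \<Rightarrow> nat list) \<Rightarrow> nat \<Rightarrow> ('w \<times> (nat \<Rightarrow> 'u)) measure" where
  "Fstar P N U Ub \<psi> k =
     vimage_algebra (space (P \<Otimes>\<^sub>M joint_actions N U))
       (\<lambda>x. (fst x, ubars \<psi> k x)) (P \<Otimes>\<^sub>M joint_actions k (\<lambda>_. Ub))"

definition property_C ::
  "'w measure \<Rightarrow> nat \<Rightarrow> (nat \<Rightarrow> 'u measure) \<Rightarrow> (nat \<Rightarrow> 'w \<times> (nat \<Rightarrow> 'u) \<Rightarrow> 'y) \<Rightarrow> 'y measure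
     \<Rightarrow> 'u measure \<Rightarrow> ('w \<times> (nat \<Rightarrow> 'u) \<Rightarrow> nat list) \<Rightarrow> bool" where
  "property_C P N U \<eta> Yb Ub \<psi> \<longleftrightarrow>
     (\<forall>k\<in>{1..N}. \<forall>s\<in>orderings N k.
        {E \<inter> {x \<in> space (P \<Otimes>\<^sub>M joint_actions N U). take k (\<psi> x) = s} | E.
           E \<in> sets (Jbar P N U \<eta> Yb \<psi> k)}
        \<subseteq> sets (Fstar P N U Ub \<psi> (k - 1)))"

end

theory Submission
  imports Defs
begin

text \<open>
  Property C says that both \<open>ybar k\<close> and the first \<open>k\<close> entries of the ordering are
  measurable with respect to the history \<open>(\<omega>, ubar 1, \<dots>, ubar (k - 1))\<close>, hence functions of it.
  To extend these functions measurably to all of \<open>\<Omega> \<times> Ub ^ (k - 1)\<close> it suffices that the set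
  of reachable histories is measurable; this follows by induction on \<open>k\<close>, because a
  reachable history of length \<open>k\<close> is one of length \<open>k - 1\<close> followed by any action
  of the DM that acts next.
\<close>

section \<open>Factorization through a map with measurable range\<close>

text \<open>Points are closed because a metrizable topology is Hausdorff. Measurable singletons turn
  measurability for a generated sigma-algebra into constancy on fibres.\<close>

lemma standard_borel_singleton:
  assumes "standard_borel K" "y \<in> space K"
  shows "{y} \<in> sets K"
proof -
  obtain X where X: "topspace X = space K" "completely_metrizable_space X"
      "sets K = sigma_sets (space K) {V. openin X V}"
    using assms(1) unfolding standard_borel_def by auto
  have "Hausdorff_space X"
    using X(2) by (intro metrizable_imp_Hausdorff_space completely_metrizable_imp_metrizable_space)
  then have "closedin X {y}"
    using X(1) assms(2) by (simp add: closedin_Hausdorff_sing_eq)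
  then have "openin X (space K - {y})"
    using X(1) by (simp add: closedin_def)
  then have "space K - {y} \<in> sets K"
    unfolding X(3) by auto
  then have "space K - (space K - {y}) \<in> sets K"
    by (rule sets.compl_sets)
  moreover have "space K - (space K - {y}) = {y}"
    using assms(2) by auto
  ultimately show ?thesis
    by simp
qed

text \<open>Every set of the generated sigma-algebra is a union of fibres of \<open>g\<close>, and
  the level set of \<open>f\<close> through \<open>x\<close> is such a set.\<close>

lemma vimage_algebra_measurable_eq:
  assumes f: "f \<in> vimage_algebra X g M \<rightarrow>\<^sub>M K"
    and g: "g \<in> X \<rightarrow> space M"
    and sing: "\<And>y. y \<in> space K \<Longrightarrow> {y} \<in> sets K"
    and x: "x \<in> X" "x' \<in> X" "g x = g x'"
  shows "f x = f x'"
proof -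
  have "f x \<in> space K"
    using measurable_space[OF f] x(1) by simp
  then have "f -` {f x} \<inter> X \<in> sets (vimage_algebra X g M)"
    using measurable_sets[OF f sing] by simp
  then obtain B where "f -` {f x} \<inter> X = g -` B \<inter> X"
    using sets_vimage_algebra2[OF g] by auto
  moreover have "x \<in> f -` {f x} \<inter> X"
    using x by simp
  ultimately have "x' \<in> f -` {f x} \<inter> X"
    using x by simp
  then show ?thesis
    by simp
qed

text \<open>
  The Doob-Dynkin factorization. Measurability of the range of \<open>g\<close> makes it
  elementary: off the range the factor is constant.
\<close>

lemma vimage_algebra_factor:
  assumes f: "f \<in> vimage_algebra X g M \<rightarrow>\<^sub>M K"
    and g: "g \<in> X \<rightarrow> space M" and range: "g ` X \<in> sets M"
    and sing: "\<And>y. y \<in> space K \<Longrightarrow> {y} \<in> sets K"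
    and c: "c \<in> space K"
  obtains h where "h \<in> M \<rightarrow>\<^sub>M K" "\<And>x. x \<in> X \<Longrightarrow> h (g x) = f x"
    "\<And>p. p \<notin> g ` X \<Longrightarrow> h p = c"
proof -
  \<comment> \<open>The choice of preimage is immaterial, as \<open>f\<close> is constant on the
    fibres of \<open>g\<close>.\<close>
  define h where "h p = (if p \<in> g ` X then f (inv_into X g p) else c)" for p
  have hg: "h (g x) = f x" if "x \<in> X" for x
  proof -
    have "f (inv_into X g (g x)) = f x"
      using that by (intro vimage_algebra_measurable_eq[OF f g sing])
        (auto intro: inv_into_into f_inv_into_f)
    then show ?thesis
      using that by (simp add: h_def)
  qed
  \<comment> \<open>The value off the range is exported because \<open>ordering_factor\<close> must
    know that two points outside the range get the same value.\<close>
  have hc: "h p = c" if "p \<notin> g ` X" for p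
    using that by (simp add: h_def)
  have "h \<in> M \<rightarrow>\<^sub>M K"
  proof (rule measurableI)
    fix p assume "p \<in> space M"
    show "h p \<in> space K"
    proof (cases "p \<in> g ` X")
      case True
      then show ?thesis
        using measurable_space[OF f] by (auto simp: hg)
    qed (simp add: hc c)
  next
    fix A assume A: "A \<in> sets K"
    then have "f -` A \<inter> X \<in> sets (vimage_algebra X g M)"
      using measurable_sets[OF f] by simp
    then obtain B where B: "B \<in> sets M" "f -` A \<inter> X = g -` B \<inter> X"
      using sets_vimage_algebra2[OF g] by auto
    \<comment> \<open>Off the range the preimage is everything or nothing, depending on whether
      \<open>c\<close> lies in \<open>A\<close>. Both pieces are measurable because the range
      is.\<close>
    have "h -` A \<inter> space M = (B \<inter> g ` X) \<union> (if c \<in> A then space M - g ` X else {})"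
    proof (rule set_eqI)
      fix p
      show "p \<in> h -` A \<inter> space M
          \<longleftrightarrow> p \<in> (B \<inter> g ` X) \<union> (if c \<in> A then space M - g ` X else {})"
      proof (cases "p \<in> g ` X")
        case True
        then obtain x where x: "x \<in> X" "p = g x" by auto
        then have "f x \<in> A \<longleftrightarrow> p \<in> B"
          using B(2) by blast
        moreover have "p \<in> space M"
          using x g by auto
        ultimately show ?thesis
          using x hg True by auto
      qed (auto simp: hc)
    qed
    then show "h -` A \<inter> space M \<in> sets M"
      using B(1) range by auto
  qed
  then show thesis
    using hg hc that by blast
qed

section \<open>Maps into and out of a union space\<close>

lemma union_space_measurable:
  assumes "union_space N X Z" "i \<in> {1..N}" "f \<in> M \<rightarrow>\<^sub>M X i"
  shows "f \<in> M \<rightarrow>\<^sub>M Z"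
proof -
  have "sets (X i) = sets (restrict_space Z (space (X i)))"
    using assms(1,2) unfolding union_space_def by auto
  then have "f \<in> M \<rightarrow>\<^sub>M restrict_space Z (space (X i))"
    using assms(3) measurable_cong_sets by blast
  then show ?thesis
    by (simp add: measurable_restrict_space2_iff)
qed

text \<open>Gluing with a constant works because the subspace is a measurable set of
  \<open>Z\<close> and carries the trace sigma-algebra. It lets a policy on \<open>Y i\<close> act
  on all of \<open>Yb\<close>.\<close>

lemma union_space_extend_measurable:
  assumes X: "union_space N X Z" and i: "i \<in> {1..N}"
    and f: "f \<in> X i \<rightarrow>\<^sub>M K" and c: "c \<in> space K"
  shows "(\<lambda>z. if z \<in> space (X i) then f z else c) \<in> Z \<rightarrow>\<^sub>M K"
proof (subst measurable_If_restrict_space_iff)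
  have eq: "sets (X i) = sets (restrict_space Z (space (X i)))"
    and mem: "space (X i) \<in> sets Z"
    using X i unfolding union_space_def by auto
  show "{z \<in> space Z. z \<in> space (X i)} \<in> sets Z"
    using mem sets.sets_into_space[OF mem] by (simp add: Collect_conj_eq Int_absorb1)
  have "f \<in> restrict_space Z (space (X i)) \<rightarrow>\<^sub>M K"
    using f measurable_cong_sets[OF eq refl] by blast
  then show "f \<in> restrict_space Z {z. z \<in> space (X i)} \<rightarrow>\<^sub>M K \<and>
      (\<lambda>_. c) \<in> restrict_space Z {z. z \<notin> space (X i)} \<rightarrow>\<^sub>M K"
    using c by simp
qed

section \<open>Combinatorics of orderings and truncated histories\<close>

lemma acting_take: "\<lbrakk>1 \<le> k; k \<le> n\<rbrakk> \<Longrightarrow> acting (take n s) k = acting s k"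
  by (simp add: acting_def)

lemma acting_in_orderings: "\<lbrakk>s \<in> orderings N m; k \<in> {1..m}\<rbrakk> \<Longrightarrow> acting s k \<in> {1..N}"
  using nth_mem[of "k - 1" s] by (auto simp: acting_def orderings_def subset_iff)

lemma acting_inj: "\<lbrakk>s \<in> orderings N m; j \<in> {1..m}; k \<in> {1..m}; acting s j = acting s k\<rbrakk> \<Longrightarrow> j = k"
  unfolding acting_def orderings_def by (auto simp: nth_eq_iff_index_eq)

text \<open>An injection of a finite set into itself is onto, so every DM has a turn.\<close>

lemma acting_surj:
  assumes "s \<in> orderings N N" "i \<in> {1..N}"
  obtains k where "k \<in> {1..N}" "acting s k = i"
proof -
  have "inj_on (acting s) {1..N}"
    using acting_inj[OF assms(1)] by (intro inj_onI) auto
  moreover have "acting s ` {1..N} \<subseteq> {1..N}"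
    using acting_in_orderings[OF assms(1)] by blast
  ultimately have "acting s ` {1..N} = {1..N}"
    by (simp add: endo_inj_surj)
  then show thesis
    using assms(2) that by (metis imageE)
qed

lemma take_in_orderings: "\<lbrakk>s \<in> orderings N N; k \<le> N\<rbrakk> \<Longrightarrow> take k s \<in> orderings N k"
  unfolding orderings_def by (auto dest: in_set_takeD)

lemma finite_orderings: "finite (orderings N k)"
  by (rule finite_subset[OF _ finite_lists_length_eq[of "{1..N}" k]]) (auto simp: orderings_def)

lemma ubars_apply: "j \<in> {1..k} \<Longrightarrow> ubars \<psi> k x j = snd x (acting (\<psi> x) j)"
  by (simp add: ubars_def ubar_def)

lemma ubars_Suc: "ubars \<psi> (Suc k) x = (ubars \<psi> k x)(Suc k := ubar \<psi> (Suc k) x)"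
  by (auto simp: ubars_def restrict_def fun_eq_iff)

lemma restrict_ubars: "j \<le> k \<Longrightarrow> restrict (ubars \<psi> k x) {1..j} = ubars \<psi> j x"
  by (auto simp: ubars_def restrict_def)

section \<open>Property C as measurability with respect to the history\<close>

text \<open>The policy is kept out of the locale: the measurements and the ordering of the imaginary
  system are built from the model alone.\<close>

locale causal_system =
  fixes P :: "'w measure" and N :: nat
    and Y :: "nat \<Rightarrow> 'y measure" and U :: "nat \<Rightarrow> 'u measure"
    and \<eta> :: "nat \<Rightarrow> 'w \<times> (nat \<Rightarrow> 'u) \<Rightarrow> 'y"
    and Yb :: "'y measure" and Ub :: "'u measure"
    and \<omega>s :: "'w \<Rightarrow> 's"
    and \<psi> :: "'w \<times> (nat \<Rightarrow> 'u) \<Rightarrow> nat list"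
  assumes sys: "dm_system P N Y U \<eta>"
    and Yb: "union_space N Y Yb" and Ub: "union_space N U Ub"
    and ord: "ordering_map P N U \<omega>s \<psi>"
    and causal: "property_C P N U \<eta> Yb Ub \<psi>"
begin

abbreviation "joint \<equiv> space (P \<Otimes>\<^sub>M joint_actions N U)"

abbreviation "histories k \<equiv> P \<Otimes>\<^sub>M joint_actions k (\<lambda>_. Ub)"

text \<open>The map that generates \<open>Fstar\<close>, named so that the factorization lemmas
  apply to it.\<close>

definition history :: "nat \<Rightarrow> 'w \<times> (nat \<Rightarrow> 'u) \<Rightarrow> 'w \<times> (nat \<Rightarrow> 'u)" where
  "history k x = (fst x, ubars \<psi> k x)"

lemma psi_orderings: "x \<in> joint \<Longrightarrow> \<psi> x \<in> orderings N N"
  using ord by (cases x) (auto simp: ordering_map_def space_pair_measure)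

lemma psi_cong: "\<lbrakk>(\<omega>, u) \<in> joint; \<omega>' \<in> space P; \<omega>s \<omega>' = \<omega>s \<omega>\<rbrakk> \<Longrightarrow> \<psi> (\<omega>', u) = \<psi> (\<omega>, u)"
  using ord by (auto simp: ordering_map_def space_pair_measure)

lemma acting_psi: "\<lbrakk>x \<in> joint; k \<in> {1..N}\<rbrakk> \<Longrightarrow> acting (\<psi> x) k \<in> {1..N}"
  using psi_orderings acting_in_orderings by blast

lemma action_in_space: "\<lbrakk>x \<in> joint; i \<in> {1..N}\<rbrakk> \<Longrightarrow> snd x i \<in> space (U i)"
  by (cases x) (auto simp: joint_actions_def space_pair_measure space_PiM)

lemma space_U_subset: "i \<in> {1..N} \<Longrightarrow> space (U i) \<subseteq> space Ub"
  using Ub unfolding union_space_def by auto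

lemma history_in_space: "\<lbrakk>x \<in> joint; k \<le> N\<rbrakk> \<Longrightarrow> history k x \<in> space (histories k)"
  using acting_psi[of x] action_in_space[of x] space_U_subset
  by (cases x) (fastforce simp: history_def joint_actions_def space_pair_measure space_PiM
      ubars_def ubar_def PiE_iff)

lemma Fstar_eq: "Fstar P N U Ub \<psi> k = vimage_algebra joint (history k) (histories k)"
  by (simp add: Fstar_def history_def[abs_def])

lemma eta_measurable: "i \<in> {1..N} \<Longrightarrow> \<eta> i \<in> P \<Otimes>\<^sub>M joint_actions N U \<rightarrow>\<^sub>M Y i"
  using sys by (simp add: dm_system_def)

lemma ybar_in_space: "\<lbrakk>x \<in> joint; k \<in> {1..N}\<rbrakk> \<Longrightarrow> ybar \<eta> \<psi> k x \<in> space (Y (acting (\<psi> x) k))"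
  using measurable_space[OF eta_measurable[OF acting_psi]] by (simp add: ybar_def)

lemma ybar_in_space_Yb: "\<lbrakk>x \<in> joint; k \<in> {1..N}\<rbrakk> \<Longrightarrow> ybar \<eta> \<psi> k x \<in> space Yb"
  using ybar_in_space[of x k] acting_psi[of x k] Yb unfolding union_space_def by auto

text \<open>Property C applied with \<open>E\<close> the preimage of \<open>A\<close> under
  \<open>ybar \<eta> \<psi> k\<close>.\<close>

lemma causality:
  assumes k: "k \<in> {1..N}" and s: "s \<in> orderings N k" and A: "A \<in> sets Yb"
  shows "{x \<in> joint. ybar \<eta> \<psi> k x \<in> A \<and> take k (\<psi> x) = s} \<in> sets (Fstar P N U Ub \<psi> (k - 1))"
proof -
  have "ybar \<eta> \<psi> k -` A \<inter> joint \<in> sets (Jbar P N U \<eta> Yb \<psi> k)"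
    unfolding Jbar_def using A by (rule in_vimage_algebra)
  then have "(ybar \<eta> \<psi> k -` A \<inter> joint) \<inter> {x \<in> joint. take k (\<psi> x) = s}
      \<in> sets (Fstar P N U Ub \<psi> (k - 1))"
    using causal[unfolded property_C_def, rule_format, OF k s] by blast
  moreover have "(ybar \<eta> \<psi> k -` A \<inter> joint) \<inter> {x \<in> joint. take k (\<psi> x) = s}
      = {x \<in> joint. ybar \<eta> \<psi> k x \<in> A \<and> take k (\<psi> x) = s}"
    by auto
  ultimately show ?thesis by simp
qed

lemma ybar_measurable:
  assumes k: "k \<in> {1..N}"
  shows "ybar \<eta> \<psi> k \<in> Fstar P N U Ub \<psi> (k - 1) \<rightarrow>\<^sub>M Yb"
proof (rule measurableI)
  fix x assume "x \<in> space (Fstar P N U Ub \<psi> (k - 1))"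
  then show "ybar \<eta> \<psi> k x \<in> space Yb"
    using ybar_in_space_Yb k by (simp add: Fstar_def)
next
  fix A assume A: "A \<in> sets Yb"
  \<comment> \<open>Property C treats one prefix at a time; the finitely many prefixes of length
    \<open>k\<close> partition \<open>joint\<close>.\<close>
  have "ybar \<eta> \<psi> k -` A \<inter> space (Fstar P N U Ub \<psi> (k - 1))
      = (\<Union>s\<in>orderings N k. {x \<in> joint. ybar \<eta> \<psi> k x \<in> A \<and> take k (\<psi> x) = s})"
    using k by (auto simp: Fstar_def intro!: take_in_orderings psi_orderings)
  also have "\<dots> \<in> sets (Fstar P N U Ub \<psi> (k - 1))"
    using causality[OF k _ A] finite_orderings by (intro sets.finite_UN) auto
  finally show "ybar \<eta> \<psi> k -` A \<inter> space (Fstar P N U Ub \<psi> (k - 1)) \<in> sets (Fstar P N U Ub \<psi> (k - 1))" .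
qed

lemma prefix_measurable:
  assumes k: "k \<in> {1..N}"
  shows "(\<lambda>x. take k (\<psi> x)) \<in> Fstar P N U Ub \<psi> (k - 1) \<rightarrow>\<^sub>M count_space (orderings N k)"
proof (subst measurable_count_space_eq2[OF finite_orderings], intro conjI ballI)
  show "(\<lambda>x. take k (\<psi> x)) \<in> space (Fstar P N U Ub \<psi> (k - 1)) \<rightarrow> orderings N k"
    using k by (auto simp: Fstar_def intro!: take_in_orderings psi_orderings)
  fix s assume s: "s \<in> orderings N k"
  \<comment> \<open>With \<open>A\<close> all of \<open>Yb\<close> the condition on the measurement
    is vacuous, and Property C isolates the prefix.\<close>
  have "(\<lambda>x. take k (\<psi> x)) -` {s} \<inter> space (Fstar P N U Ub \<psi> (k - 1))
      = {x \<in> joint. ybar \<eta> \<psi> k x \<in> space Yb \<and> take k (\<psi> x) = s}"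
    using ybar_in_space_Yb k by (auto simp: Fstar_def)
  then show "(\<lambda>x. take k (\<psi> x)) -` {s} \<inter> space (Fstar P N U Ub \<psi> (k - 1))
      \<in> sets (Fstar P N U Ub \<psi> (k - 1))"
    using causality[OF k s sets.top] by simp
qed

text \<open>A measurable map into a discrete space is constant on the fibres of the generating map.
  Note the shift: \<open>k - 1\<close> actions fix \<open>k\<close> entries of the ordering.\<close>

lemma history_determines_prefix:
  assumes k: "k \<in> {1..N}" and x: "x \<in> joint" "x' \<in> joint"
    and eq: "history (k - 1) x = history (k - 1) x'"
  shows "take k (\<psi> x) = take k (\<psi> x')"
  using k x eq
  by (intro vimage_algebra_measurable_eq[OF prefix_measurable[OF k, unfolded Fstar_eq]])
    (auto intro: history_in_space)

lemma history_determines_acting: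
  "\<lbrakk>k \<in> {1..N}; x \<in> joint; x' \<in> joint; history (k - 1) x = history (k - 1) x'\<rbrakk>
    \<Longrightarrow> acting (\<psi> x) k = acting (\<psi> x') k"
  using history_determines_prefix[of k x x'] acting_take[of k k] by (metis atLeastAtMost_iff order_refl)

lemma acting_measurable:
  assumes k: "k \<in> {1..N}"
  shows "(\<lambda>x. acting (\<psi> x) k) \<in> Fstar P N U Ub \<psi> (k - 1) \<rightarrow>\<^sub>M count_space {1..N}"
proof -
  have "(\<lambda>s. acting s k) \<in> count_space (orderings N k) \<rightarrow>\<^sub>M count_space {1..N}"
    using acting_in_orderings k by (auto simp: measurable_def)
  from measurable_compose[OF prefix_measurable[OF k] this] show ?thesis
    using k by (simp add: acting_take)
qed

section \<open>Measurability of the set of reachable histories\<close>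

lemma joint_actions_nonempty: "space (joint_actions N U) \<noteq> {}"
  using sys by (auto simp: dm_system_def joint_actions_def space_PiM PiE_eq_empty_iff)

text \<open>The product over no stages has one point, so an empty history carries only \<omega>, and
  each \<omega> is reached because some joint action exists.\<close>

lemma history_0_image: "history 0 ` joint = space (histories 0)"
proof -
  have "history 0 x = (fst x, \<lambda>_. undefined)" for x
    by (simp add: history_def ubars_def restrict_def)
  then show ?thesis
    using joint_actions_nonempty
    by (force simp: joint_actions_def space_pair_measure space_PiM image_iff)
qed

text \<open>Equal histories make the same DM act next, so only the action of that DM has to be
  compared.\<close>

lemma history_Suc_cong:
  assumes k: "Suc k \<le> N" and x: "x \<in> joint" "x' \<in> joint"
    and eq: "history k x = history k x'"
    and last: "snd x (acting (\<psi> x) (Suc k)) = snd x' (acting (\<psi> x) (Suc k))"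
  shows "history (Suc k) x = history (Suc k) x'"
proof -
  have "acting (\<psi> x) (Suc k) = acting (\<psi> x') (Suc k)"
    using history_determines_acting[of "Suc k" x x'] k x eq by simp
  then show ?thesis
    using eq last by (simp add: history_def ubars_Suc ubar_def)
qed

text \<open>Only the ordering at \<open>u\<close> occurs in the hypothesis: inductively, agreement
  so far forces the ordering at \<open>u'\<close> to name the same next DM.\<close>

lemma history_cong:
  assumes "k \<le> N" and x: "(\<omega>, u) \<in> joint" "(\<omega>, u') \<in> joint"
    and "\<forall>j\<in>{1..k}. u (acting (\<psi> (\<omega>, u)) j) = u' (acting (\<psi> (\<omega>, u)) j)"
  shows "history k (\<omega>, u) = history k (\<omega>, u')"
  using assms(1,4)
proof (induction k)
  case 0
  show ?case by (simp add: history_def ubars_def restrict_def)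
next
  case (Suc k)
  then show ?case
    by (intro history_Suc_cong x) auto
qed

text \<open>Nothing constrains the action of the next DM beyond its own action space.\<close>

lemma history_extend:
  assumes k: "Suc k \<le> N" and x: "(\<omega>, u) \<in> joint"
    and a: "a \<in> space (U (acting (\<psi> (\<omega>, u)) (Suc k)))"
  defines "u' \<equiv> u(acting (\<psi> (\<omega>, u)) (Suc k) := a)"
  shows "(\<omega>, u') \<in> joint" and "history k (\<omega>, u') = history k (\<omega>, u)"
    and "ubars \<psi> (Suc k) (\<omega>, u') (Suc k) = a"
proof -
  let ?i = "acting (\<psi> (\<omega>, u)) (Suc k)"
  have "?i \<in> {1..N}"
    using acting_psi[OF x] k by simp
  then show x': "(\<omega>, u') \<in> joint"
    using x a by (auto simp: u'_def joint_actions_def space_pair_measure space_PiM PiE_iff extensional_def)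
  \<comment> \<open>An ordering has no repetitions, so the changed coordinate belongs to none of the
    first \<open>k\<close> DMs.\<close>
  have "?i \<noteq> acting (\<psi> (\<omega>, u)) j" if "j \<in> {1..k}" for j
    using acting_inj[OF psi_orderings[OF x], of j "Suc k"] that k by auto
  then have "\<forall>j\<in>{1..k}. u (acting (\<psi> (\<omega>, u)) j) = u' (acting (\<psi> (\<omega>, u)) j)"
    unfolding u'_def by (metis fun_upd_other)
  then show h: "history k (\<omega>, u') = history k (\<omega>, u)"
    using k by (intro history_cong[symmetric] x x') simp_all
  \<comment> \<open>The new action may reorder later DMs, but not change who acts at stage
    \<open>Suc k\<close>, since the history up to \<open>k\<close> is unchanged.\<close>
  show "ubars \<psi> (Suc k) (\<omega>, u') (Suc k) = a"
    using history_determines_acting[of "Suc k" "(\<omega>, u')" "(\<omega>, u)"] x x' h k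
    by (simp add: ubars_apply u'_def)
qed

text \<open>The inclusion from right to left is the substantial one: in a joint action realizing the
  shorter history, the action of the next DM is replaced by the prescribed one, as in
  \<open>history_extend\<close>.\<close>

lemma history_Suc_image:
  assumes k: "Suc k \<le> N"
  shows "history (Suc k) ` joint = {(\<omega>, v) \<in> space (histories (Suc k)).
     \<exists>x\<in>joint. history k x = (\<omega>, restrict v {1..k}) \<and> v (Suc k) \<in> space (U (acting (\<psi> x) (Suc k)))}"
    (is "?L = ?R")
proof (intro equalityI subsetI)
  fix p assume "p \<in> ?L"
  then obtain x where x: "x \<in> joint" "p = history (Suc k) x" by auto
  moreover have "ubars \<psi> (Suc k) x (Suc k) \<in> space (U (acting (\<psi> x) (Suc k)))"
    using action_in_space[OF x(1) acting_psi[OF x(1)]] k by (simp add: ubars_apply)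
  moreover have "history (Suc k) x \<in> space (histories (Suc k))"
    using history_in_space x k by blast
  ultimately show "p \<in> ?R"
    using restrict_ubars[of k "Suc k" \<psi> x] by (auto simp: history_def simp del: One_nat_def)
next
  fix p assume "p \<in> ?R"
  then obtain \<omega> v x where p: "p = (\<omega>, v)" "(\<omega>, v) \<in> space (histories (Suc k))"
    and x: "x \<in> joint" "history k x = (\<omega>, restrict v {1..k})"
      "v (Suc k) \<in> space (U (acting (\<psi> x) (Suc k)))"
    by auto
  obtain u where u: "x = (\<omega>, u)"
    using x(2) by (cases x) (auto simp: history_def)
  define u' where "u' = u(acting (\<psi> (\<omega>, u)) (Suc k) := v (Suc k))"
  note ext = history_extend[OF k x(1)[unfolded u] x(3)[unfolded u], folded u'_def]
  have "ubars \<psi> (Suc k) (\<omega>, u') = v"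
  proof
    fix j
    have "ubars \<psi> k (\<omega>, u') = restrict v {1..k}"
      using ext(2) x(2) u by (simp add: history_def)
    then have "ubars \<psi> (Suc k) (\<omega>, u') j = v j" if "j \<in> {1..k}"
      using that ubars_apply[of j k \<psi> "(\<omega>, u')"] ubars_apply[of j "Suc k" \<psi> "(\<omega>, u')"] by simp
    moreover have "v j = undefined" if "j \<notin> {1..Suc k}"
      using p(2) that by (auto simp: joint_actions_def space_pair_measure space_PiM PiE_iff extensional_def)
    ultimately show "ubars \<psi> (Suc k) (\<omega>, u') j = v j"
      using ext(3) by (cases "j \<in> {1..k}"; cases "j = Suc k") (auto simp: ubars_def)
  qed
  then have "p = history (Suc k) (\<omega>, u')"
    by (simp add: history_def p)
  then show "p \<in> ?L"
    using ext(1) by blast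
qed

lemma restrict_history_measurable:
  "j \<le> k \<Longrightarrow> (\<lambda>p. (fst p, restrict (snd p) {1..j})) \<in> histories k \<rightarrow>\<^sub>M histories j"
  unfolding joint_actions_def
  by (intro measurable_Pair measurable_fst measurable_compose[OF measurable_snd]
      measurable_restrict_subset) auto

text \<open>Measurability of the range is a hypothesis because the lemma is used inside the
  induction that proves it, in \<open>history_image_measurable\<close>.\<close>

lemma acting_factor:
  assumes k: "k \<in> {1..N}" and D: "history (k - 1) ` joint \<in> sets (histories (k - 1))"
  obtains h where "h \<in> histories (k - 1) \<rightarrow>\<^sub>M count_space {1..N}"
    "\<And>x. x \<in> joint \<Longrightarrow> h (history (k - 1) x) = acting (\<psi> x) k"
    "\<And>p. p \<notin> history (k - 1) ` joint \<Longrightarrow> h p = 1"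
proof (rule vimage_algebra_factor[OF acting_measurable[OF k, unfolded Fstar_eq] _ D])
  show "history (k - 1) \<in> joint \<rightarrow> space (histories (k - 1))"
    using history_in_space k by auto
  show "{i} \<in> sets (count_space {1..N})" if "i \<in> space (count_space {1..N})" for i
    using that by simp
  show "(1::nat) \<in> space (count_space {1..N})"
    using k by simp
qed (rule that)

lemma history_image_measurable: "k \<le> N \<Longrightarrow> history k ` joint \<in> sets (histories k)"
proof (induction k)
  case 0
  show ?case by (simp add: history_0_image)
next
  case (Suc k)
  define r :: "'w \<times> (nat \<Rightarrow> 'u) \<Rightarrow> 'w \<times> (nat \<Rightarrow> 'u)"
    where "r p = (fst p, restrict (snd p) {1..k})" for p
  have [measurable]: "r \<in> histories (Suc k) \<rightarrow>\<^sub>M histories k"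
    unfolding r_def by (rule restrict_history_measurable) simp
  have [measurable]: "history k ` joint \<in> sets (histories k)"
    using Suc by simp
  have "Suc k \<in> {1..N}" "history (Suc k - 1) ` joint \<in> sets (histories (Suc k - 1))"
    using Suc by auto
  note factor = acting_factor[OF this, unfolded diff_Suc_1]
  obtain h where h[measurable]: "h \<in> histories k \<rightarrow>\<^sub>M count_space {1..N}"
    and hx: "\<And>x. x \<in> joint \<Longrightarrow> h (history k x) = acting (\<psi> x) (Suc k)"
    by (rule factor) (erule that, blast)
  have [measurable]: "(\<lambda>p. snd p (Suc k)) \<in> histories (Suc k) \<rightarrow>\<^sub>M Ub"
    unfolding joint_actions_def
    by (intro measurable_compose[OF measurable_snd] measurable_component_singleton) simp
  have U[measurable]: "space (U i) \<in> sets Ub" if "i \<in> {1..N}" for i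
    using Ub that unfolding union_space_def by auto
  \<comment> \<open>Since \<open>h\<close> computes the next DM from the truncated history, the
    witness \<open>x\<close> survives only in membership of the reachable set of length
    \<open>k\<close>, and a finite union over \<open>i\<close> remains.\<close>
  have "history (Suc k) ` joint = {p \<in> space (histories (Suc k)). r p \<in> history k ` joint \<and>
      (\<exists>i\<in>{1..N}. h (r p) = i \<and> snd p (Suc k) \<in> space (U i))}"
  proof (unfold history_Suc_image[OF Suc.prems], intro set_eqI iffI)
    fix p
    assume "p \<in> {(\<omega>, v) \<in> space (histories (Suc k)). \<exists>x\<in>joint.
      history k x = (\<omega>, restrict v {1..k}) \<and> v (Suc k) \<in> space (U (acting (\<psi> x) (Suc k)))}"
    then obtain x where x: "p \<in> space (histories (Suc k))" "x \<in> joint" "history k x = r p"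
        "snd p (Suc k) \<in> space (U (acting (\<psi> x) (Suc k)))"
      unfolding r_def by (cases p) auto
    then show "p \<in> {p \<in> space (histories (Suc k)). r p \<in> history k ` joint \<and>
      (\<exists>i\<in>{1..N}. h (r p) = i \<and> snd p (Suc k) \<in> space (U i))}"
      using hx[OF x(2)] acting_psi[OF x(2), of "Suc k"] Suc.prems by (auto intro: rev_image_eqI)
  next
    fix p
    assume "p \<in> {p \<in> space (histories (Suc k)). r p \<in> history k ` joint \<and>
      (\<exists>i\<in>{1..N}. h (r p) = i \<and> snd p (Suc k) \<in> space (U i))}"
    then obtain x where x: "p \<in> space (histories (Suc k))" "x \<in> joint" "history k x = r p"
        "snd p (Suc k) \<in> space (U (h (r p)))"
      by (smt (verit) imageE mem_Collect_eq)
    then have "snd p (Suc k) \<in> space (U (acting (\<psi> x) (Suc k)))"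
      using hx[OF x(2)] by simp
    then show "p \<in> {(\<omega>, v) \<in> space (histories (Suc k)). \<exists>x\<in>joint.
      history k x = (\<omega>, restrict v {1..k}) \<and> v (Suc k) \<in> space (U (acting (\<psi> x) (Suc k)))}"
      using x(1-3) unfolding r_def by (cases p) auto
  qed
  also have "\<dots> \<in> sets (histories (Suc k))"
    by measurable
  finally show ?case .
qed

section \<open>Measurements and ordering as functions of the history\<close>

text \<open>The factor becomes the measurement function of the \<open>k\<close>-th imaginary
  DM.\<close>

lemma ybar_factor:
  assumes k: "k \<in> {1..N}"
  obtains h where "h \<in> histories (k - 1) \<rightarrow>\<^sub>M Yb"
    "\<And>x. x \<in> joint \<Longrightarrow> h (history (k - 1) x) = ybar \<eta> \<psi> k x"
proof -
  have "joint \<noteq> {}"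
  proof -
    have "space P \<noteq> {}"
      using sys by (simp add: dm_system_def prob_space.not_empty)
    then show ?thesis
      using joint_actions_nonempty by (auto simp: space_pair_measure)
  qed
  \<comment> \<open>Any attained measurement serves as the value at unreachable histories.\<close>
  then obtain c where c: "c \<in> space Yb"
    using ybar_in_space_Yb k by blast
  show thesis
  proof (rule vimage_algebra_factor[OF ybar_measurable[OF k, unfolded Fstar_eq] _ _ _ c])
    show "history (k - 1) \<in> joint \<rightarrow> space (histories (k - 1))"
      using history_in_space k by auto
    show "history (k - 1) ` joint \<in> sets (histories (k - 1))"
      using k by (intro history_image_measurable) auto
    show "{y} \<in> sets Yb" if "y \<in> space Yb" for y
      using Yb that by (intro standard_borel_singleton) (simp_all add: union_space_def)
  qed (rule that)
qed

text \<open>As \<open>h\<close> arises by choosing representatives of the fibres of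
  \<open>\<omega>s\<close>, measurability is asserted for its composite with
  \<open>\<omega>s\<close>.\<close>

lemma ordering_factor:
  assumes k: "k \<in> {1..N}"
  obtains h :: "'s \<times> (nat \<Rightarrow> 'u) \<Rightarrow> nat"
  where "(\<lambda>(\<omega>, v). h (\<omega>s \<omega>, v)) \<in> histories (k - 1) \<rightarrow>\<^sub>M count_space {1..N}"
    "\<And>\<omega> u. (\<omega>, u) \<in> joint \<Longrightarrow> h (\<omega>s \<omega>, ubars \<psi> (k - 1) (\<omega>, u)) = acting (\<psi> (\<omega>, u)) k"
proof -
  have "history (k - 1) ` joint \<in> sets (histories (k - 1))"
    using k by (intro history_image_measurable) auto
  from acting_factor[OF k this]
  obtain f where f: "f \<in> histories (k - 1) \<rightarrow>\<^sub>M count_space {1..N}"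
    and fx: "\<And>x. x \<in> joint \<Longrightarrow> f (history (k - 1) x) = acting (\<psi> x) k"
    and f1: "\<And>p. p \<notin> history (k - 1) ` joint \<Longrightarrow> f p = 1"
    by blast
  text \<open>
    The range of \<open>history\<close> is saturated with respect to \<open>\<omega>s\<close>, so \<open>f\<close> depends on \<open>\<omega>\<close>
    through \<open>\<omega>s\<close> everywhere, and any representative \<open>\<omega>\<close> may be chosen.
  \<close>
  have saturated: "f (\<omega>', v) = f (\<omega>, v)"
    if \<omega>: "\<omega> \<in> space P" "\<omega>' \<in> space P" "\<omega>s \<omega>' = \<omega>s \<omega>"
      and mem: "(\<omega>, v) \<in> history (k - 1) ` joint" for \<omega> \<omega>' v
  proof -
    obtain u where u: "(\<omega>, u) \<in> joint" "v = ubars \<psi> (k - 1) (\<omega>, u)"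
      using mem by (auto simp: history_def)
    \<comment> \<open>The same joint action at \<omega>' yields the same ordering, hence the same
      \<open>ubars\<close>, so \<open>v\<close> is reachable from \<omega>' too.\<close>
    have psi: "\<psi> (\<omega>', u) = \<psi> (\<omega>, u)"
      by (rule psi_cong[OF u(1) \<omega>(2,3)])
    then have "v = ubars \<psi> (k - 1) (\<omega>', u)"
      by (simp add: u(2) ubars_def ubar_def)
    moreover have "(\<omega>', u) \<in> joint"
      using u(1) \<omega> by (simp add: space_pair_measure)
    ultimately show ?thesis
      using fx[of "(\<omega>', u)"] fx[OF u(1)] psi u(2) by (simp add: history_def)
  qed
  \<comment> \<open>If either point is in the range, saturation applies in one of the two
    directions; otherwise both values are the default 1.\<close>
  have dep: "f (\<omega>', v) = f (\<omega>, v)"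
    if "\<omega> \<in> space P" "\<omega>' \<in> space P" "\<omega>s \<omega>' = \<omega>s \<omega>" for \<omega> \<omega>' v
    using saturated[OF that] saturated[OF that(2,1) that(3)[symmetric]] f1[of "(\<omega>, v)"] f1[of "(\<omega>', v)"]
    by metis
  define h where "h = (\<lambda>(w, v). f (inv_into (space P) \<omega>s w, v))"
  have h: "h (\<omega>s \<omega>, v) = f (\<omega>, v)" if "\<omega> \<in> space P" for \<omega> v
    using that dep[OF that, of "inv_into (space P) \<omega>s (\<omega>s \<omega>)"]
    by (simp add: h_def inv_into_into f_inv_into_f)
  have "f \<in> histories (k - 1) \<rightarrow>\<^sub>M count_space {1..N}
      \<longleftrightarrow> (\<lambda>(\<omega>, v). h (\<omega>s \<omega>, v)) \<in> histories (k - 1) \<rightarrow>\<^sub>M count_space {1..N}"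
    by (rule measurable_cong) (auto simp: space_pair_measure h)
  with f have "(\<lambda>(\<omega>, v). h (\<omega>s \<omega>, v)) \<in> histories (k - 1) \<rightarrow>\<^sub>M count_space {1..N}"
    by (rule iffD1[rotated])
  moreover have "h (\<omega>s \<omega>, ubars \<psi> (k - 1) (\<omega>, u)) = acting (\<psi> (\<omega>, u)) k" if "(\<omega>, u) \<in> joint" for \<omega> u
    using fx[OF that] that by (simp add: history_def h space_pair_measure)
  ultimately show thesis
    by (rule that)
qed

section \<open>Policies and the closed loop of the imaginary system\<close>

text \<open>The index of the acting DM is an argument because the \<open>Y i\<close> may overlap, so
  a measurement alone need not reveal whose policy applies.\<close>

lemma policy_extension:
  assumes \<gamma>: "\<gamma> \<in> policies N Y U" and N: "1 \<le> N"
  obtains g where "g \<in> Yb \<Otimes>\<^sub>M count_space {1..N} \<rightarrow>\<^sub>M Ub"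
    "\<And>i y. \<lbrakk>i \<in> {1..N}; y \<in> space (Y i)\<rbrakk> \<Longrightarrow> g (y, i) = \<gamma> i y"
proof -
  have "space (U 1) \<noteq> {}" "space (U 1) \<subseteq> space Ub"
    using sys N space_U_subset by (auto simp: dm_system_def)
  then obtain c where c: "c \<in> space Ub" by auto
  define g where "g = (\<lambda>(y, i). if y \<in> space (Y i) then \<gamma> i y else c)"
  have slice: "(\<lambda>y. g (y, i)) \<in> Yb \<rightarrow>\<^sub>M Ub" if i: "i \<in> {1..N}" for i
  proof -
    have "\<gamma> i \<in> Y i \<rightarrow>\<^sub>M Ub"
      using \<gamma> i by (intro union_space_measurable[OF Ub i]) (simp add: policies_def)
    from union_space_extend_measurable[OF Yb i this c] show ?thesis
      by (simp add: g_def)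
  qed
  \<comment> \<open>Slicewise measurability suffices because the index set is countable.\<close>
  have "(\<lambda>p. g (fst p, snd p)) \<in> Yb \<Otimes>\<^sub>M count_space {1..N} \<rightarrow>\<^sub>M Ub"
    by (rule measurable_compose_countable'[where f="\<lambda>i p. g (fst p, i)" and g=snd and I="{1..N}"])
      (auto intro: measurable_compose[OF measurable_fst slice])
  then have "g \<in> Yb \<Otimes>\<^sub>M count_space {1..N} \<rightarrow>\<^sub>M Ub"
    by simp
  then show thesis
    using that by (simp add: g_def)
qed

text \<open>
  A solution \<open>v\<close> of the imaginary closed loop is built up action by action; each
  action is one of the DM that acts next, so \<open>v\<close> never leaves the reachable histories.
\<close>

lemma closed_loop_iff:
  fixes \<eta>b \<psi>b \<gamma>b \<gamma>
  assumes \<gamma>: "\<gamma> \<in> policies N Y U"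
    and \<eta>b: "\<And>k \<omega> v. k \<in> {1..N} \<Longrightarrow> \<eta>b k (\<omega>, v) = H k (\<omega>, restrict v {1..k - 1})"
    and H: "\<And>k x. \<lbrakk>k \<in> {1..N}; x \<in> joint\<rbrakk> \<Longrightarrow> H k (history (k - 1) x) = ybar \<eta> \<psi> k x"
    and \<psi>b: "\<And>k \<omega> u. \<lbrakk>k \<in> {1..N}; (\<omega>, u) \<in> joint\<rbrakk>
      \<Longrightarrow> \<psi>b k (\<omega>s \<omega>, ubars \<psi> (k - 1) (\<omega>, u)) = acting (\<psi> (\<omega>, u)) k"
    and \<gamma>b: "\<And>k i y. \<lbrakk>k \<in> {1..N}; i \<in> {1..N}; y \<in> space (Y i)\<rbrakk> \<Longrightarrow> \<gamma>b k (y, i) = \<gamma> i y"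
    and \<omega>: "\<omega> \<in> space P" and v: "v \<in> space (joint_actions N (\<lambda>_. Ub))"
  shows "(\<forall>k\<in>{1..N}. v k = \<gamma>b k (\<eta>b k (\<omega>, v), \<psi>b k (\<omega>s \<omega>, restrict v {1..k - 1})))
    \<longleftrightarrow> (\<exists>u\<in>space (joint_actions N U).
          (\<forall>i\<in>{1..N}. u i = \<gamma> i (\<eta> i (\<omega>, u))) \<and> v = ubars \<psi> N (\<omega>, u))"
    (is "?L \<longleftrightarrow> ?R")
proof -
  \<comment> \<open>At a reachable history, one stage of the imaginary loop reproduces the decision
    of the original DM whose turn it is.\<close>
  have step: "\<gamma>b k (\<eta>b k (\<omega>, v), \<psi>b k (\<omega>s \<omega>, restrict v {1..k - 1}))
      = \<gamma> (acting (\<psi> (\<omega>, u)) k) (\<eta> (acting (\<psi> (\<omega>, u)) k) (\<omega>, u))"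
    if k: "k \<in> {1..N}" and x: "(\<omega>, u) \<in> joint"
      and res: "restrict v {1..k - 1} = ubars \<psi> (k - 1) (\<omega>, u)" for k u
  proof -
    have "\<eta>b k (\<omega>, v) = ybar \<eta> \<psi> k (\<omega>, u)"
      using \<eta>b[OF k] H[OF k x] res by (simp add: history_def)
    then show ?thesis
      using \<psi>b[OF k x] res \<gamma>b[OF k acting_psi[OF x k] ybar_in_space[OF x k]]
      by (simp add: ybar_def)
  qed
  show ?thesis
  proof
    assume L: ?L
    have reach: "(\<omega>, restrict v {1..k}) \<in> history k ` joint" if "k \<le> N" for k
      using that
    proof (induction k)
      case 0
      show ?case
        unfolding history_0_image
        using \<omega> by (simp add: joint_actions_def space_pair_measure space_PiM restrict_def)
    next
      case (Suc k)
      then obtain x where "x \<in> joint" "history k x = (\<omega>, restrict v {1..k})"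
        by (metis Suc_leD imageE)
      then obtain u where u: "(\<omega>, u) \<in> joint" "restrict v {1..k} = ubars \<psi> k (\<omega>, u)"
        by (metis Pair_inject history_def prod.collapse)
      have k: "Suc k \<in> {1..N}"
        using Suc by simp
      note i = acting_psi[OF u(1) k]
      have "\<gamma> (acting (\<psi> (\<omega>, u)) (Suc k)) \<in> Y (acting (\<psi> (\<omega>, u)) (Suc k))
          \<rightarrow>\<^sub>M U (acting (\<psi> (\<omega>, u)) (Suc k))"
        using \<gamma> i by (simp add: policies_def)
      \<comment> \<open>The policy value lies in the action space of the acting DM, not merely in
        \<open>Ub\<close>, which keeps the extended history reachable.\<close>
      from measurable_space[OF this ybar_in_space[OF u(1) k]]
      have "v (Suc k) \<in> space (U (acting (\<psi> (\<omega>, u)) (Suc k)))"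
        using L k step[OF k u(1)] u(2) by (simp add: ybar_def)
      moreover have "restrict (restrict v {1..Suc k}) {1..k} = restrict v {1..k}"
        by (auto simp: restrict_def)
      moreover have "(\<omega>, restrict v {1..Suc k}) \<in> space (histories (Suc k))"
        using \<omega> v k by (auto simp: joint_actions_def space_pair_measure space_PiM PiE_iff)
      ultimately show ?case
        using u by (subst history_Suc_image[OF Suc.prems])
          (auto simp: history_def intro!: bexI[of _ "(\<omega>, u)"])
    qed
    have "restrict v {1..N} = v"
      using v by (auto simp: joint_actions_def space_PiM)
    then obtain u where u: "(\<omega>, u) \<in> joint" "v = ubars \<psi> N (\<omega>, u)"
      using reach[of N] by (auto simp: history_def)
    \<comment> \<open>Each DM acts at some stage \<open>k\<close>, and the loop equation for
      \<open>v k\<close> there is its own equation.\<close>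
    have "u i = \<gamma> i (\<eta> i (\<omega>, u))" if i: "i \<in> {1..N}" for i
    proof -
      obtain k where k: "k \<in> {1..N}" "acting (\<psi> (\<omega>, u)) k = i"
        using acting_surj[OF psi_orderings[OF u(1)] i] by blast
      have "restrict v {1..k - 1} = ubars \<psi> (k - 1) (\<omega>, u)"
        unfolding u(2) using k by (intro restrict_ubars) auto
      from step[OF k(1) u(1) this] show ?thesis
        using L k u(2) ubars_apply[OF k(1), of \<psi> "(\<omega>, u)"] by simp
    qed
    then show ?R
      using u by (intro bexI[of _ u]) (auto simp: space_pair_measure)
  next
    assume ?R
    then obtain u where u: "u \<in> space (joint_actions N U)"
        "\<forall>i\<in>{1..N}. u i = \<gamma> i (\<eta> i (\<omega>, u))" "v = ubars \<psi> N (\<omega>, u)"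
      by blast
    then have x: "(\<omega>, u) \<in> joint"
      using \<omega> by (simp add: space_pair_measure)
    show ?L
    proof
      fix k assume k: "k \<in> {1..N}"
      have "restrict v {1..k - 1} = ubars \<psi> (k - 1) (\<omega>, u)"
        unfolding u(3) using k by (intro restrict_ubars) auto
      from step[OF k x this]
      show "v k = \<gamma>b k (\<eta>b k (\<omega>, v), \<psi>b k (\<omega>s \<omega>, restrict v {1..k - 1}))"
        using u(2,3) acting_psi[OF x k] ubars_apply[OF k, of \<psi> "(\<omega>, u)"] by simp
    qed
  qed
qed

text \<open>Each \<open>\<eta>b k\<close> reads its second argument only through the coordinates
  \<open>1\<close> to \<open>k - 1\<close>; this gives both measurability, by composition with a
  restriction, and independence of the present and later actions.\<close>

lemma sequential_systemI:
  assumes \<eta>b: "\<And>k \<omega> v. k \<in> {1..N} \<Longrightarrow> \<eta>b k (\<omega>, v) = H k (\<omega>, restrict v {1..k - 1})"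
    and H: "\<And>k. k \<in> {1..N} \<Longrightarrow> H k \<in> histories (k - 1) \<rightarrow>\<^sub>M Yb"
  shows "sequential_system P N (\<lambda>_. Yb) (\<lambda>_. Ub) \<eta>b [1..<Suc N]"
proof -
  have "\<eta>b k \<in> histories N \<rightarrow>\<^sub>M Yb" if k: "k \<in> {1..N}" for k
  proof -
    have "\<eta>b k = (\<lambda>p. H k (fst p, restrict (snd p) {1..k - 1}))"
      using \<eta>b[OF k] by (auto simp: fun_eq_iff)
    then show ?thesis
      using measurable_compose[OF restrict_history_measurable H[OF k], of N] k by auto
  qed
  moreover have "space Ub \<noteq> {}" if "k \<in> {1..N}" for k
    using sys that space_U_subset[OF that] by (auto simp: dm_system_def)
  ultimately have "dm_system P N (\<lambda>_. Yb) (\<lambda>_. Ub) \<eta>b"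
    using sys Yb Ub by (auto simp: dm_system_def union_space_def)
  moreover have "[1..<Suc N] \<in> orderings N N"
    by (auto simp: orderings_def)
  moreover have act: "acting [1..<Suc N] k = k" if "k \<in> {1..N}" for k
    using that by (auto simp: acting_def simp del: upt_Suc)
  moreover have "\<eta>b k (\<omega>, u) = \<eta>b k (\<omega>, u')"
    if k: "k \<in> {1..N}" and eq: "\<forall>j\<in>{1..<k}. u (acting [1..<Suc N] j) = u' (acting [1..<Suc N] j)"
    for k \<omega> u u'
  proof -
    have "restrict u {1..k - 1} = restrict u' {1..k - 1}"
    proof (rule restrict_ext)
      fix j assume "j \<in> {1..k - 1}"
      then have "j \<in> {1..<k}" "j \<in> {1..N}"
        using k by auto
      then show "u j = u' j"
        using eq act by metis
    qed
    then show ?thesis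
      by (simp only: \<eta>b[OF k])
  qed
  ultimately show ?thesis
    unfolding sequential_system_def by (simp del: upt_Suc)
qed

end

section \<open>Assembly of the imaginary system from the factors\<close>

theorem proposition2p2:
  fixes P :: "'w measure" and N :: nat
    and Y :: "nat \<Rightarrow> 'y measure" and U :: "nat \<Rightarrow> 'u measure"
    and \<eta> :: "nat \<Rightarrow> 'w \<times> (nat \<Rightarrow> 'u) \<Rightarrow> 'y"
    and Yb :: "'y measure" and Ub :: "'u measure"
    and S0 :: "'s measure" and \<omega>s :: "'w \<Rightarrow> 's"
    and \<psi> :: "'w \<times> (nat \<Rightarrow> 'u) \<Rightarrow> nat list"
    and \<gamma> :: "nat \<Rightarrow> 'y \<Rightarrow> 'u"
  assumes "dm_system P N Y U \<eta>"
    and "union_space N Y Yb" and "union_space N U Ub"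
    and "\<omega>s \<in> P \<rightarrow>\<^sub>M S0"
    and "ordering_map P N U \<omega>s \<psi>"
    and "property_C P N U \<eta> Yb Ub \<psi>"
    and "\<gamma> \<in> policies N Y U"
  shows "\<exists>(\<eta>b :: nat \<Rightarrow> 'w \<times> (nat \<Rightarrow> 'u) \<Rightarrow> 'y) (\<psi>b :: nat \<Rightarrow> 's \<times> (nat \<Rightarrow> 'u) \<Rightarrow> nat)
           (\<gamma>b :: nat \<Rightarrow> 'y \<times> nat \<Rightarrow> 'u).
      \<comment> \<open>a sequential system in which DM \<open>k\<close> acts \<open>k\<close>-th\<close>
      sequential_system P N (\<lambda>_. Yb) (\<lambda>_. Ub) \<eta>b [1..<Suc N] \<and>
      \<comment> \<open>\<open>s_k\<close> as a function of \<open>\<omega>s\<close> and the earlier actions; policies acting on \<open>(ybar k, s_k)\<close>\<close>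
      (\<forall>k\<in>{1..N}.
         (\<lambda>(\<omega>, v). \<psi>b k (\<omega>s \<omega>, v))
           \<in> P \<Otimes>\<^sub>M joint_actions (k - 1) (\<lambda>_. Ub) \<rightarrow>\<^sub>M count_space {1..N} \<and>
         \<gamma>b k \<in> Yb \<Otimes>\<^sub>M count_space {1..N} \<rightarrow>\<^sub>M Ub \<and>
         (\<forall>i\<in>{1..N}. \<forall>y\<in>space (Y i). \<gamma>b k (y, i) = \<gamma> i y)) \<and>
      \<comment> \<open>its measurements are the \<open>ybar k\<close> when its actions are the \<open>ubar k\<close>\<close>
      (\<forall>k\<in>{1..N}. \<forall>\<omega>\<in>space P. \<forall>u\<in>space (joint_actions N U).
         \<psi>b k (\<omega>s \<omega>, ubars \<psi> (k - 1) (\<omega>, u)) = acting (\<psi> (\<omega>, u)) k \<and>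
         \<eta>b k (\<omega>, ubars \<psi> N (\<omega>, u)) = ybar \<eta> \<psi> k (\<omega>, u)) \<and>
      \<comment> \<open>under these policies its actions are the \<open>ubar k\<close> of the original system under \<open>\<gamma>\<close>\<close>
      (\<forall>\<omega>\<in>space P. \<forall>v\<in>space (joint_actions N (\<lambda>_. Ub)).
         (\<forall>k\<in>{1..N}. v k = \<gamma>b k (\<eta>b k (\<omega>, v), \<psi>b k (\<omega>s \<omega>, restrict v {1..k - 1}))) \<longleftrightarrow>
         (\<exists>u\<in>space (joint_actions N U).
            (\<forall>i\<in>{1..N}. u i = \<gamma> i (\<eta> i (\<omega>, u))) \<and> v = ubars \<psi> N (\<omega>, u)))"
proof -
  interpret causal_system P N Y U \<eta> Yb Ub \<omega>s \<psi>
    by unfold_locales (use assms in auto)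
  have "\<forall>k\<in>{1..N}. \<exists>h. h \<in> histories (k - 1) \<rightarrow>\<^sub>M Yb \<and>
      (\<forall>x\<in>joint. h (history (k - 1) x) = ybar \<eta> \<psi> k x)"
    using ybar_factor by metis
  then obtain H where H: "\<And>k. k \<in> {1..N} \<Longrightarrow> H k \<in> histories (k - 1) \<rightarrow>\<^sub>M Yb"
      "\<And>k x. \<lbrakk>k \<in> {1..N}; x \<in> joint\<rbrakk> \<Longrightarrow> H k (history (k - 1) x) = ybar \<eta> \<psi> k x"
    by metis
  have "\<forall>k\<in>{1..N}. \<exists>h :: 's \<times> (nat \<Rightarrow> 'u) \<Rightarrow> nat.
      (\<lambda>(\<omega>, v). h (\<omega>s \<omega>, v)) \<in> histories (k - 1) \<rightarrow>\<^sub>M count_space {1..N} \<and>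
      (\<forall>\<omega> u. (\<omega>, u) \<in> joint \<longrightarrow> h (\<omega>s \<omega>, ubars \<psi> (k - 1) (\<omega>, u)) = acting (\<psi> (\<omega>, u)) k)"
  proof
    fix k assume "k \<in> {1..N}"
    then show "\<exists>h :: 's \<times> (nat \<Rightarrow> 'u) \<Rightarrow> nat.
      (\<lambda>(\<omega>, v). h (\<omega>s \<omega>, v)) \<in> histories (k - 1) \<rightarrow>\<^sub>M count_space {1..N} \<and>
      (\<forall>\<omega> u. (\<omega>, u) \<in> joint \<longrightarrow> h (\<omega>s \<omega>, ubars \<psi> (k - 1) (\<omega>, u)) = acting (\<psi> (\<omega>, u)) k)"
      by (rule ordering_factor) blast
  qed
  from bchoice[OF this] obtain \<psi>b :: "nat \<Rightarrow> 's \<times> (nat \<Rightarrow> 'u) \<Rightarrow> nat"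
    where \<psi>b: "\<And>k. k \<in> {1..N} \<Longrightarrow>
        (\<lambda>(\<omega>, v). \<psi>b k (\<omega>s \<omega>, v)) \<in> histories (k - 1) \<rightarrow>\<^sub>M count_space {1..N}"
      "\<And>k \<omega> u. \<lbrakk>k \<in> {1..N}; (\<omega>, u) \<in> joint\<rbrakk>
        \<Longrightarrow> \<psi>b k (\<omega>s \<omega>, ubars \<psi> (k - 1) (\<omega>, u)) = acting (\<psi> (\<omega>, u)) k"
    by blast
  \<comment> \<open>The implication covers \<open>N = 0\<close>, where \<open>Ub\<close> is empty
    and offers no default action.\<close>
  have "\<exists>g. 1 \<le> N \<longrightarrow> g \<in> Yb \<Otimes>\<^sub>M count_space {1..N} \<rightarrow>\<^sub>M Ub \<and>
      (\<forall>i\<in>{1..N}. \<forall>y\<in>space (Y i). g (y, i) = \<gamma> i y)"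
    using policy_extension[OF assms(7)] by metis
  then obtain g where g: "1 \<le> N \<Longrightarrow> g \<in> Yb \<Otimes>\<^sub>M count_space {1..N} \<rightarrow>\<^sub>M Ub"
      "\<And>i y. \<lbrakk>i \<in> {1..N}; y \<in> space (Y i)\<rbrakk> \<Longrightarrow> g (y, i) = \<gamma> i y"
    by (metis atLeastAtMost_iff order_trans)
  \<comment> \<open>\<open>H k\<close> lives on histories of length \<open>k - 1\<close>, so a full
    action profile is cut to that length first.\<close>
  define \<eta>b where "\<eta>b k = (\<lambda>(\<omega>, v). H k (\<omega>, restrict v {1..k - 1}))" for k
  have \<eta>b: "\<eta>b k (\<omega>, v) = H k (\<omega>, restrict v {1..k - 1})" for k \<omega> v
    by (simp add: \<eta>b_def)
  show ?thesis
  \<comment> \<open>One \<open>g\<close> serves all stages, because the stage influences the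
    decision only through the measurement and the index of the acting DM.\<close>
  proof (intro exI[of _ \<eta>b] exI[of _ \<psi>b] exI[of _ "\<lambda>_. g"] conjI ballI)
    show "sequential_system P N (\<lambda>_. Yb) (\<lambda>_. Ub) \<eta>b [1..<Suc N]"
      using \<eta>b H(1) by (rule sequential_systemI)
  next
    fix k \<omega> u
    assume k: "k \<in> {1..N}" and "\<omega> \<in> space P" "u \<in> space (joint_actions N U)"
    then have x: "(\<omega>, u) \<in> joint"
      by (simp add: space_pair_measure)
    then show "\<psi>b k (\<omega>s \<omega>, ubars \<psi> (k - 1) (\<omega>, u)) = acting (\<psi> (\<omega>, u)) k"
      by (rule \<psi>b(2)[OF k])
    show "\<eta>b k (\<omega>, ubars \<psi> N (\<omega>, u)) = ybar \<eta> \<psi> k (\<omega>, u)"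
      using H(2)[OF k x] diff_le_self[of k 1] k
      by (subst \<eta>b, subst restrict_ubars) (auto simp: history_def)
  next
    fix \<omega> v assume "\<omega> \<in> space P" "v \<in> space (joint_actions N (\<lambda>_. Ub))"
    then show "(\<forall>k\<in>{1..N}. v k = g (\<eta>b k (\<omega>, v), \<psi>b k (\<omega>s \<omega>, restrict v {1..k - 1}))) \<longleftrightarrow>
         (\<exists>u\<in>space (joint_actions N U).
            (\<forall>i\<in>{1..N}. u i = \<gamma> i (\<eta> i (\<omega>, u))) \<and> v = ubars \<psi> N (\<omega>, u))"
      using closed_loop_iff[where \<gamma>b="\<lambda>_. g", OF assms(7) \<eta>b H(2) \<psi>b(2) g(2)] by blast
  qed (use \<psi>b(1) g in auto)
qed

end
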